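(* Let $p$ be a prime and let $k$ be an integer with $1\le k\le p-1$. Let $\mathcal{A}=(a_i)_{i=0}^\infty$ be the sequence over $\mathbb{F}_p$ defined by $$a_i=\binom{i+k}{k}\bmod p,\qquad i=0,1,\ldots.$$ Then $$L(\mathcal{A})=k+1,$$ and for every positive integer $N$, $$L_N(\mathcal{A})\ge \min\{k+1,\lceil N/2\rceil,p-k\}.$$
   Context: $\mathbb{F}_p$ is the field with $p$ elements. For a sequence $\mathcal{S}=(s_i)_{i=0}^\infty$ over a finite field $\mathbb{F}_q$ and a positive integer $N$, the $N$th linear complexity $L_N(\mathcal{S})$ is the least nonnegative integer $L_N$ for which there are $c_0,\ldots,c_{L_N-1}\in\mathbb{F}_q$ with $s_{i+L_N}+\sum_{\ell=0}^{L_N-1}c_\ell s_{i+\ell}=0$ for $0\le i\le N-L_N-1$ (with $L_N=0$ if $s_0=\cdots=s_{N-1}=0$, and $L_N=N$ if $s_0=\cdots=s_{N-2}=0\neq s_{N-1}$). The linear complexity is $L(\mathcal{S})=\sup_{N\ge1}L_N(\mathcal{S})$. *)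

theory Defs
  imports "HOL-Number_Theory.Number_Theory" "HOL-Library.Extended_Nat"
begin

text \<open>
  The index range \<open>0 \<le> i \<le> N - L - 1\<close> is written \<open>i + L < N\<close>, which avoids
  truncated subtraction: for \<open>L = N\<close> the range is empty.
\<close>

definition nth_linear_complexity ::
  "('a, 'm) ring_scheme \<Rightarrow> (nat \<Rightarrow> 'a) \<Rightarrow> nat \<Rightarrow> nat" where
  "nth_linear_complexity R s N =
     (LEAST L. \<exists>c. (\<forall>l<L. c l \<in> carrier R) \<and>
        (\<forall>i. i + L < N \<longrightarrow>
           s (i + L) \<oplus>\<^bsub>R\<^esub> (\<Oplus>\<^bsub>R\<^esub>l\<in>{..<L}. c l \<otimes>\<^bsub>R\<^esub> s (i + l)) = \<zero>\<^bsub>R\<^esub>))"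

text \<open>The supremum is taken in \<^typ>\<open>enat\<close>, since it may be infinite.\<close>

definition linear_complexity ::
  "('a, 'm) ring_scheme \<Rightarrow> (nat \<Rightarrow> 'a) \<Rightarrow> enat" where
  "linear_complexity R s = (SUP N\<in>{1..}. enat (nth_linear_complexity R s N))"

text \<open>
  The two conventions usually stated for degenerate initial segments are
  consequences of the minimality in \<^const>\<open>nth_linear_complexity\<close>.
\<close>

lemma nth_linear_complexity_zero_segment:
  assumes "ring R" and "\<And>i. i < N \<Longrightarrow> s i = \<zero>\<^bsub>R\<^esub>"
  shows "nth_linear_complexity R s N = 0"
proof -
  interpret ring R by fact
  show ?thesis
    unfolding nth_linear_complexity_def
    by (rule Least_eq_0) (use assms(2) in auto)
qed

lemma nth_linear_complexity_late_nonzero: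
  assumes "ring R" and "N \<ge> 1" and "s (N - 1) \<in> carrier R"
    and zero: "\<And>i. i < N - 1 \<Longrightarrow> s i = \<zero>\<^bsub>R\<^esub>" and nz: "s (N - 1) \<noteq> \<zero>\<^bsub>R\<^esub>"
  shows "nth_linear_complexity R s N = N"
proof -
  interpret ring R by fact
  show ?thesis
    unfolding nth_linear_complexity_def
  proof (rule Least_equality)
    show "\<exists>c. (\<forall>l<N. c l \<in> carrier R) \<and>
        (\<forall>i. i + N < N \<longrightarrow>
           s (i + N) \<oplus>\<^bsub>R\<^esub> (\<Oplus>\<^bsub>R\<^esub>l\<in>{..<N}. c l \<otimes>\<^bsub>R\<^esub> s (i + l)) = \<zero>\<^bsub>R\<^esub>)"
      by (intro exI[of _ "\<lambda>_. \<zero>\<^bsub>R\<^esub>"]) auto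
  next
    fix L
    assume "\<exists>c. (\<forall>l<L. c l \<in> carrier R) \<and>
        (\<forall>i. i + L < N \<longrightarrow>
           s (i + L) \<oplus>\<^bsub>R\<^esub> (\<Oplus>\<^bsub>R\<^esub>l\<in>{..<L}. c l \<otimes>\<^bsub>R\<^esub> s (i + l)) = \<zero>\<^bsub>R\<^esub>)"
    then obtain c where c: "\<And>l. l < L \<Longrightarrow> c l \<in> carrier R"
      and rec: "\<And>i. i + L < N \<Longrightarrow>
           s (i + L) \<oplus>\<^bsub>R\<^esub> (\<Oplus>\<^bsub>R\<^esub>l\<in>{..<L}. c l \<otimes>\<^bsub>R\<^esub> s (i + l)) = \<zero>\<^bsub>R\<^esub>"
      by blast
    show "N \<le> L"
    proof (rule ccontr)
      assume "\<not> N \<le> L"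
      then have L: "N - 1 - L + L = N - 1" "N - 1 - L + L < N"
        using assms(2) by auto
      have "c l \<otimes>\<^bsub>R\<^esub> s (N - 1 - L + l) = \<zero>\<^bsub>R\<^esub>" if "l < L" for l
      proof -
        have "N - 1 - L + l < N - 1" using that L(1) by linarith
        then have "s (N - 1 - L + l) = \<zero>\<^bsub>R\<^esub>" by (rule zero)
        then show ?thesis using c[OF that] by simp
      qed
      then have "(\<Oplus>\<^bsub>R\<^esub>l\<in>{..<L}. c l \<otimes>\<^bsub>R\<^esub> s (N - 1 - L + l)) = \<zero>\<^bsub>R\<^esub>"
        by (intro add.finprod_one_eqI) auto
      with rec[OF L(2)] L(1) assms(3) nz show False by simp
    qed
  qed
qed

end

theory Submission imports Defs "HOL-Computational_Algebra.Polynomial" begin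

text \<open>
  Modulo a prime \<open>p > k\<close> the sequence \<open>i \<mapsto> (i + k) choose k\<close> is a polynomial function of degree
  \<open>k\<close>: multiplied by the unit \<open>k!\<close> it becomes \<open>(i + 1) \<dots> (i + k)\<close>. Its difference of order
  \<open>k + 1\<close> therefore vanishes, which is a linear recurrence of order \<open>k + 1\<close>.

  For the lower bounds, suppose that a recurrence with coefficients \<open>c\<^sub>0, \<dots>, c\<^sub>L\<close>, where
  \<open>c\<^sub>L = 1\<close> and \<open>L \<le> k\<close>, holds on the first \<open>N\<close> terms, and consider the polynomial
  \<open>F(x) = \<Sum>\<^sub>l c\<^sub>l (x + l + 1) \<dots> (x + l + k)\<close>, of degree at most \<open>k\<close>. The recurrence says that
  \<open>F(i)\<close> is \<open>0\<close> modulo \<open>p\<close> whenever \<open>i + L < N\<close>. On the other hand \<open>F(-L) = k!\<close>, because at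
  \<open>x = -L\<close> every summand with \<open>l < L\<close> contains the factor \<open>0\<close>. So \<open>F\<close> does not vanish at \<open>-L\<close>
  modulo \<open>p\<close>, and this is contradicted in two ways.

  If \<open>N > p\<close>, then \<open>F(p - L)\<close>, which is congruent to \<open>F(-L)\<close>, must vanish. Hence the
  complexity reaches \<open>k + 1\<close> at \<open>N = p + 1\<close>.

  If \<open>2 L < N\<close> and \<open>L + k < p\<close>, then \<open>F\<close> vanishes at \<open>0, \<dots>, L\<close>, and it also vanishes at
  \<open>-k, \<dots>, -(L + 1)\<close>, since there all summands contain the factor \<open>0\<close>. These \<open>k + 1\<close> points are
  pairwise incongruent modulo \<open>p\<close>, so \<open>F\<close> vanishes everywhere modulo \<open>p\<close>.
\<close>

section \<open>Linear recurrences modulo an integer\<close>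

definition recurrence_mod :: "int \<Rightarrow> (nat \<Rightarrow> int) \<Rightarrow> nat \<Rightarrow> nat \<Rightarrow> (nat \<Rightarrow> int) \<Rightarrow> bool" where
  "recurrence_mod m s N L c \<longleftrightarrow> (\<forall>i. i + L < N \<longrightarrow> m dvd s (i + L) + (\<Sum>l<L. c l * s (i + l)))"

lemma residue_ring_recurrence_iff:
  fixes m :: int and s c :: "nat \<Rightarrow> int"
  assumes "m > 1"
  shows "(s (i + L) mod m) \<oplus>\<^bsub>residue_ring m\<^esub>
           (\<Oplus>\<^bsub>residue_ring m\<^esub>l\<in>{..<L}. c l \<otimes>\<^bsub>residue_ring m\<^esub> (s (i + l) mod m))
           = \<zero>\<^bsub>residue_ring m\<^esub>
         \<longleftrightarrow> m dvd s (i + L) + (\<Sum>l<L. c l * s (i + l))"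
proof -
  interpret residues m "residue_ring m"
    using assms by unfold_locales
  have "(\<Oplus>\<^bsub>residue_ring m\<^esub>l\<in>{..<L}. c l \<otimes>\<^bsub>residue_ring m\<^esub> (s (i + l) mod m))
          = (\<Oplus>\<^bsub>residue_ring m\<^esub>l\<in>{..<L}. (c l * s (i + l)) mod m)"
    by (simp add: res_mult_eq mod_mult_right_eq)
  also have "\<dots> = (\<Sum>l<L. c l * s (i + l)) mod m"
    by (rule sum_cong) auto
  finally show ?thesis
    by (simp add: res_add_eq res_zero_eq mod_add_eq dvd_eq_mod_eq_0)
qed

text \<open>
  Over \<open>\<int>/m\<close> the coefficients may be taken to be arbitrary integers, since reducing them modulo
  \<open>m\<close> does not affect the recurrence.
\<close>
lemma nth_linear_complexity_residue_ring:
  fixes m :: int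
  assumes "m > 1"
  shows "nth_linear_complexity (residue_ring m) (\<lambda>i. s i mod m) N
           = (LEAST L. \<exists>c. recurrence_mod m s N L c)"
proof -
  interpret residues m "residue_ring m"
    using assms by unfold_locales
  have "(\<exists>c. (\<forall>l<L. c l \<in> carrier (residue_ring m)) \<and> recurrence_mod m s N L c)
          \<longleftrightarrow> (\<exists>c. recurrence_mod m s N L c)" for L
  proof
    assume "\<exists>c. recurrence_mod m s N L c"
    then obtain c where c: "recurrence_mod m s N L c" ..
    have "[s (i + L) + (\<Sum>l<L. c l mod m * s (i + l)) =
           s (i + L) + (\<Sum>l<L. c l * s (i + l))] (mod m)" for i
      by (intro cong_add cong_sum cong_mult cong_refl) (simp add: cong_def)
    with c have "recurrence_mod m s N L (\<lambda>l. c l mod m)"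
      unfolding recurrence_mod_def using cong_dvd_iff by blast
    moreover have "\<forall>l<L. c l mod m \<in> carrier (residue_ring m)"
      using assms by (simp add: res_carrier_eq)
    ultimately show "\<exists>c. (\<forall>l<L. c l \<in> carrier (residue_ring m)) \<and> recurrence_mod m s N L c"
      by (intro exI[of _ "\<lambda>l. c l mod m"] conjI)
  qed blast
  then show ?thesis
    by (simp only: nth_linear_complexity_def residue_ring_recurrence_iff[OF assms]
        recurrence_mod_def[symmetric])
qed

lemma nth_linear_complexity_residue_ring_le:
  fixes m :: int
  assumes "m > 1" and "recurrence_mod m s N L c"
  shows "nth_linear_complexity (residue_ring m) (\<lambda>i. s i mod m) N \<le> L"
  unfolding nth_linear_complexity_residue_ring[OF assms(1)]
  using assms(2) by (blast intro: Least_le)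

lemma nth_linear_complexity_residue_ring_attained:
  fixes m :: int
  assumes "m > 1"
  obtains c where "recurrence_mod m s N (nth_linear_complexity (residue_ring m) (\<lambda>i. s i mod m) N) c"
proof -
  \<comment> \<open>For order \<open>N\<close> the recurrence has no instance to satisfy.\<close>
  have "\<exists>c. recurrence_mod m s N N c"
    by (simp add: recurrence_mod_def)
  then have "\<exists>c. recurrence_mod m s N (LEAST L. \<exists>c. recurrence_mod m s N L c) c"
    by (rule LeastI)
  then show ?thesis
    using that unfolding nth_linear_complexity_residue_ring[OF assms] by blast
qed

section \<open>The recurrence satisfied by binomial coefficients\<close>

text \<open>
  One forward difference can be split off an iterated difference, by Pascal's rule for the
  coefficients.
\<close>
lemma sum_alternating_binomial_Suc:
  fixes f :: "nat \<Rightarrow> 'a :: comm_ring_1"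
  shows "(\<Sum>l\<le>Suc n. (-1) ^ (Suc n - l) * of_nat (Suc n choose l) * f l)
           = (\<Sum>l\<le>n. (-1) ^ (n - l) * of_nat (n choose l) * (f (Suc l) - f l))"
proof -
  have "(\<Sum>l\<le>Suc n. (-1) ^ (Suc n - l) * of_nat (Suc n choose l) * f l)
          = (-1) ^ Suc n * f 0
            + (\<Sum>l\<le>n. (-1) ^ (n - l) * of_nat ((n choose l) + (n choose Suc l)) * f (Suc l))"
    by (subst sum.atMost_Suc_shift) simp
  also have "\<dots> = (\<Sum>l\<le>n. (-1) ^ (n - l) * of_nat (n choose l) * f (Suc l))
      + ((-1) ^ Suc n * f 0 + (\<Sum>l\<le>n. (-1) ^ (n - l) * of_nat (n choose Suc l) * f (Suc l)))"
    by (simp add: algebra_simps sum.distrib)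
  also have "(-1) ^ Suc n * f 0 + (\<Sum>l\<le>n. (-1) ^ (n - l) * of_nat (n choose Suc l) * f (Suc l))
      = (\<Sum>l\<le>Suc n. (-1) ^ (Suc n - l) * of_nat (n choose l) * f l)"
    by (subst sum.atMost_Suc_shift) simp
  also have "\<dots> = - (\<Sum>l\<le>n. (-1) ^ (n - l) * of_nat (n choose l) * f l)"
    by (simp add: sum_negf[symmetric] Suc_diff_le binomial_eq_0)
  finally show ?thesis
    by (simp add: algebra_simps sum_subtractf)
qed

text \<open>By Pascal's rule each difference lowers the lower index by one, until it drops below \<open>0\<close>.\<close>
lemma sum_alternating_binomial_choose:
  assumes "k < n"
  shows "(\<Sum>l\<le>n. (-1) ^ (n - l) * int (n choose l) * int ((i + l) choose k)) = 0"
  using assms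
proof (induction n arbitrary: k)
  case (Suc n)
  show ?case
  proof (cases k)
    case 0
    then show ?thesis
      by (subst sum_alternating_binomial_Suc) simp
  next
    case (Suc k')
    then show ?thesis
      using Suc.IH[of k'] Suc.prems by (subst sum_alternating_binomial_Suc) simp
  qed
qed simp

lemma recurrence_mod_binomial:
  "recurrence_mod m (\<lambda>i. int ((i + k) choose k)) N (k + 1)
     (\<lambda>l. (-1) ^ (k + 1 - l) * int ((k + 1) choose l))"
  unfolding recurrence_mod_def
proof (intro allI impI)
  fix i
  have "(\<Sum>l\<le>k + 1. (-1) ^ (k + 1 - l) * int ((k + 1) choose l) * int ((i + k + l) choose k)) = 0"
    by (rule sum_alternating_binomial_choose) simp
  then show "m dvd int ((i + (k + 1) + k) choose k) +
      (\<Sum>l<k + 1. (-1) ^ (k + 1 - l) * int ((k + 1) choose l) * int ((i + l + k) choose k))"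
    by (simp add: lessThan_Suc_atMost ac_simps)
qed

section \<open>Integer polynomials modulo a prime\<close>

text \<open>
  Lagrange's bound on the number of roots over the field with \<open>q\<close> elements: splitting off the
  linear factor of one root leaves a polynomial of smaller degree that still vanishes at the others.
\<close>
lemma poly_dvd_of_many_roots_mod_prime:
  fixes P :: "int poly"
  assumes "prime q" and "finite X" and "degree P < card X"
    and "\<And>x. x \<in> X \<Longrightarrow> q dvd poly P x"
    and "\<And>x y. x \<in> X \<Longrightarrow> y \<in> X \<Longrightarrow> x \<noteq> y \<Longrightarrow> \<not> q dvd x - y"
  shows "q dvd poly P z"
  using assms(2-)
proof (induction X arbitrary: P rule: finite_induct)
  case (insert a X)
  define Q where "Q = synthetic_div P a"
  have split: "poly P x = (x - a) * poly Q x + poly P a" for x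
  proof -
    have "poly P x = poly ([:-a, 1:] * Q + [:poly P a:]) x"
      unfolding Q_def by (simp only: synthetic_div_correct')
    then show ?thesis by (simp add: algebra_simps)
  qed
  have root: "q dvd poly P a"
    using insert.prems(2) by simp
  show ?case
  proof (cases "degree P = 0")
    case True
    then obtain b where "P = [:b:]"
      by (rule degree_eq_zeroE)
    then show ?thesis
      using root by simp
  next
    case False
    have "q dvd poly Q z"
    proof (rule insert.IH)
      show "degree Q < card X"
        using insert.prems(1) insert.hyps False by (simp add: Q_def degree_synthetic_div)
      show "q dvd poly Q x" if "x \<in> X" for x
      proof -
        have "q dvd (x - a) * poly Q x"
          using insert.prems(2)[of x] that root split[of x] by (simp add: dvd_add_left_iff)
        moreover have "\<not> q dvd x - a"
          using insert.prems(3)[of x a] that insert.hyps by auto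
        ultimately show ?thesis
          using assms(1) prime_dvd_mult_iff by blast
      qed
    qed (use insert.prems(3) in auto)
    then show ?thesis
      using root split[of z] by simp
  qed
qed simp

section \<open>The polynomial of a short recurrence\<close>

text \<open>
  The polynomial \<open>F\<close> of the introduction. The leading coefficient \<open>1\<close> of the recurrence is a
  separate summand, so that \<open>c\<close> is the same function as in \<^const>\<open>recurrence_mod\<close>.
\<close>
definition recurrence_poly :: "nat \<Rightarrow> nat \<Rightarrow> (nat \<Rightarrow> int) \<Rightarrow> int poly" where
  "recurrence_poly k L c =
     (\<Prod>j\<in>{1..k}. [:int L + int j, 1:])
       + (\<Sum>l<L. smult (c l) (\<Prod>j\<in>{1..k}. [:int l + int j, 1:]))"

lemma poly_recurrence_poly:
  "poly (recurrence_poly k L c) x =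
     (\<Prod>j\<in>{1..k}. x + int L + int j) + (\<Sum>l<L. c l * (\<Prod>j\<in>{1..k}. x + int l + int j))"
  by (simp add: recurrence_poly_def poly_sum poly_prod algebra_simps)

lemma degree_recurrence_poly_le: "degree (recurrence_poly k L c) \<le> k"
proof -
  have "degree (\<Prod>j\<in>{1..k}. [:int l + int j, 1:]) \<le> k" for l
    using degree_prod_sum_le[of "{1..k}" "\<lambda>j. [:int l + int j, 1:]"] by simp
  then show ?thesis
    unfolding recurrence_poly_def
    by (intro degree_add_le degree_sum_le) (auto intro: order.trans[OF degree_smult_le])
qed

lemma fact_mult_binomial_eq_prod: "fact k * int ((n + k) choose k) = (\<Prod>j\<in>{1..k}. int n + int j)"
proof (induction k)
  case (Suc k)
  have "fact (Suc k) * int ((n + Suc k) choose Suc k)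
          = fact k * int (Suc k * (Suc (n + k) choose Suc k))"
    by (simp add: algebra_simps del: binomial_Suc_Suc)
  also have "Suc k * (Suc (n + k) choose Suc k) = Suc (n + k) * ((n + k) choose k)"
    by (rule Suc_times_binomial)
  also have "fact k * int (Suc (n + k) * ((n + k) choose k)) =
      (fact k * int ((n + k) choose k)) * (int n + int (Suc k))"
    by (simp add: algebra_simps)
  also have "\<dots> = (\<Prod>j\<in>{1..Suc k}. int n + int j)"
    unfolding Suc.IH by simp
  finally show ?case .
qed simp

lemma recurrence_poly_dvd:
  assumes "recurrence_mod m (\<lambda>i. int ((i + k) choose k)) N L c" and "i + L < N"
  shows "m dvd poly (recurrence_poly k L c) (int i)"
proof -
  have "(\<Prod>j\<in>{1..k}. int i + int l + int j) = fact k * int ((i + l + k) choose k)" for l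
    using fact_mult_binomial_eq_prod[of k "i + l"] by simp
  then have "poly (recurrence_poly k L c) (int i)
    = fact k * (int ((i + L + k) choose k) + (\<Sum>l<L. c l * int ((i + l + k) choose k)))"
    unfolding poly_recurrence_poly distrib_left sum_distrib_left
    by (simp add: mult.left_commute)
  with assms show ?thesis
    by (simp add: recurrence_mod_def)
qed

lemma prod_consecutive_eq_0:
  fixes x :: int
  assumes "- int k \<le> x" and "x < 0"
  shows "(\<Prod>j\<in>{1..k}. x + int j) = 0"
  using assms by (intro prod_zero bexI[of _ "nat (- x)"]) auto

lemma recurrence_poly_at_minus_order:
  assumes "L \<le> k"
  shows "poly (recurrence_poly k L c) (- int L) = fact k"
proof -
  have "(\<Prod>j\<in>{1..k}. - int L + int l + int j) = 0" if "l < L" for l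
    using that assms by (intro prod_consecutive_eq_0) auto
  then have "poly (recurrence_poly k L c) (- int L) = (\<Prod>j\<in>{1..k}. int j)"
    by (simp add: poly_recurrence_poly cong: sum.cong_simp del: prod_zero_iff)
  then show ?thesis
    by (simp add: fact_prod)
qed

lemma recurrence_poly_at_left_roots:
  assumes "L < j" and "j \<le> k"
  shows "poly (recurrence_poly k L c) (- int j) = 0"
proof -
  have "(\<Prod>i\<in>{1..k}. - int j + int l + int i) = 0" if "l \<le> L" for l
    using that assms by (intro prod_consecutive_eq_0) auto
  then show ?thesis
    by (simp add: poly_recurrence_poly cong: sum.cong_simp del: prod_zero_iff)
qed

section \<open>Lower bounds for the order of a recurrence\<close>

lemma recurrence_poly_not_dvd_at_minus_order:
  assumes "prime (p :: nat)" and "k < p" and "L \<le> k"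
  shows "\<not> int p dvd poly (recurrence_poly k L c) (- int L)"
  using assms prime_dvd_fact_iff[of p k] int_dvd_int_iff[of p "fact k"]
  by (simp add: recurrence_poly_at_minus_order)

text \<open>
  After a full period the instance \<open>i = p - L\<close> of the recurrence is available, and \<open>p - L\<close> is
  congruent to the point \<open>-L\<close> where the polynomial does not vanish.
\<close>
lemma recurrence_binomial_order_gt:
  assumes "prime p" and "k < p" and "p < N"
    and rec: "recurrence_mod (int p) (\<lambda>i. int ((i + k) choose k)) N L c"
  shows "k < L"
proof (rule ccontr)
  assume "\<not> k < L"
  then have L: "L \<le> k" by simp
  let ?F = "recurrence_poly k L c"
  have "int p dvd poly ?F (int (p - L))"
    using rec by (rule recurrence_poly_dvd) (use assms L in auto)
  moreover have "[poly ?F (int (p - L)) = poly ?F (- int L)] (mod int p)"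
    unfolding poly_recurrence_poly
    by (intro cong_add cong_sum cong_mult cong_prod cong_refl)
       (use assms L in \<open>simp_all add: cong_iff_dvd_diff of_nat_diff\<close>)
  ultimately show False
    using recurrence_poly_not_dvd_at_minus_order[OF assms(1,2) L] cong_dvd_iff by blast
qed

text \<open>
  If all three alternatives fail, then \<open>i = 0, \<dots>, L\<close> are instances of the recurrence by
  \<open>2 L < N\<close>, and the resulting roots lie with \<open>-k, \<dots>, -(L + 1)\<close> in an interval of length
  \<open>L + k < p\<close>, which makes them incongruent modulo \<open>p\<close>.
\<close>
lemma recurrence_binomial_order_lower_bound:
  assumes "prime p" and "k < p"
    and rec: "recurrence_mod (int p) (\<lambda>i. int ((i + k) choose k)) N L c"
  shows "k < L \<or> N \<le> 2 * L \<or> p \<le> L + k"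
proof (rule ccontr)
  assume "\<not> ?thesis"
  then have L: "L \<le> k" "2 * L < N" "L + k < p" by auto
  let ?F = "recurrence_poly k L c"
  define X where "X = {- int k..- int L - 1} \<union> {0..int L}"
  have "int p dvd poly ?F (- int L)"
  proof (rule poly_dvd_of_many_roots_mod_prime)
    have "card X = card {- int k..- int L - 1} + card {0..int L}"
      unfolding X_def by (rule card_Un_disjoint) auto
    with L have "card X = k + 1" by simp
    then show "degree ?F < card X"
      using degree_recurrence_poly_le[of k L c] by simp
    show "int p dvd poly ?F x" if "x \<in> X" for x
    proof (cases "x < 0")
      case True
      then obtain j where "x = - int j" "L < j" "j \<le> k"
        using \<open>x \<in> X\<close> by (intro that[of "nat (- x)"]) (auto simp: X_def)
      then show ?thesis
        by (simp add: recurrence_poly_at_left_roots)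
    next
      case False
      then obtain i where "x = int i" "i \<le> L"
        using \<open>x \<in> X\<close> by (intro that[of "nat x"]) (auto simp: X_def)
      then show ?thesis
        using recurrence_poly_dvd[OF rec, of i] L by simp
    qed
    show "\<not> int p dvd x - y" if "x \<in> X" "y \<in> X" "x \<noteq> y" for x y
    proof
      assume "int p dvd x - y"
      then have "int p \<le> \<bar>x - y\<bar>"
        using that(3) by (intro zdvd_imp_le) auto
      with that L show False
        by (auto simp: X_def)
    qed
  qed (use assms(1) in \<open>auto simp: X_def\<close>)
  then show False
    using recurrence_poly_not_dvd_at_minus_order[OF assms(1,2) L(1)] by blast
qed

section \<open>The linear complexity of the binomial sequence\<close>

theorem proposition1:
  fixes p k :: nat and a :: "nat \<Rightarrow> int"
  assumes "prime p" and "1 \<le> k" and "k \<le> p - 1"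
    and "\<And>i. a i = int ((i + k) choose k) mod int p"
  shows "linear_complexity (residue_ring (int p)) a = enat (k + 1) \<and>
    (\<forall>N::nat. N \<ge> 1 \<longrightarrow>
       int (nth_linear_complexity (residue_ring (int p)) a N)
         \<ge> Min {int k + 1, \<lceil>real N / 2\<rceil>, int p - int k})"
proof -
  let ?b = "\<lambda>i. int ((i + k) choose k)"
  let ?L = "nth_linear_complexity (residue_ring (int p)) a"
  have p: "int p > 1" "k < p"
    using assms(2,3) prime_gt_1_nat[OF assms(1)] by auto
  have a: "a = (\<lambda>i. ?b i mod int p)"
    using assms(4) by auto
  have upper: "?L N \<le> k + 1" for N
    unfolding a by (rule nth_linear_complexity_residue_ring_le[OF p(1) recurrence_mod_binomial])
  have attained: "\<exists>c. recurrence_mod (int p) ?b N (?L N) c" for N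
    unfolding a using nth_linear_complexity_residue_ring_attained[OF p(1)] by blast
  have "k + 1 \<le> ?L (p + 1)"
    using attained[of "p + 1"] recurrence_binomial_order_gt[OF assms(1) p(2), of "p + 1"] by force
  then have "enat (k + 1) \<le> linear_complexity (residue_ring (int p)) a"
    unfolding linear_complexity_def by (intro SUP_upper2[of "p + 1"]) auto
  moreover have "linear_complexity (residue_ring (int p)) a \<le> enat (k + 1)"
    unfolding linear_complexity_def by (intro SUP_least) (use upper in simp)
  moreover have "int (?L N) \<ge> Min {int k + 1, \<lceil>real N / 2\<rceil>, int p - int k}" for N
  proof -
    have "k < ?L N \<or> N \<le> 2 * ?L N \<or> p \<le> ?L N + k"
      using attained recurrence_binomial_order_lower_bound[OF assms(1) p(2)] by blast
    moreover have "\<lceil>real N / 2\<rceil> \<le> int (?L N)" if "N \<le> 2 * ?L N"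
      using that by (simp add: ceiling_le_iff)
    ultimately show ?thesis
      by auto
  qed
  ultimately show ?thesis
    by (auto intro: order.antisym)
qed

end
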